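(* Let $R$ be a proper $*$-ring and let $a\in R$ be Drazin invertible with Drazin index $k$. If $a^k$ has a $\{1,3\}$-inverse $(a^k)^{(1,3)}$, then $a$ is weak core invertible; moreover, $a^{\boxplus}=a^{D}a^k(a^k)^{(1,3)}$ and $aa^{\boxplus}=a^k(a^k)^{(1,3)}$.
   Context: A proper $*$-ring is a (not necessarily commutative) ring $R$ with unit $1\ne 0$ and an involution $r\mapsto r^*$ satisfying $(r^* )^*=r$, $(r+s)^*=r^*+s^*$, $(rs)^*=s^*r^*$, such that $r^*r=0$ implies $r=0$. A $\{1,3\}$-inverse of $b\in R$ is an element $z=b^{(1,3)}$ with $bzb=b$ and $(bz)^*=bz$. The Drazin inverse $a^D$ of $a$ is the (unique, if it exists) $z\in R$ with $zaz=z$, $az=za$ and $za^{k+1}=a^k$ for some positive integer $k$; the smallest such positive integer $k$ is the Drazin index of $a$. An element $y\in R$ is a weak core inverse of $a\in R$ if for some positive integer $k$ one has $ya^{k+1}=a^k$, $ay^2=y$ and $(a^k)^*ay=(a^k)^*$. In a proper $*$-ring it is unique if it exists and is denoted $a^{\boxplus}$; $a$ is then called weak core invertible. *)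

theory Defs
  imports Main
begin

class star_ring = ring_1 +
  fixes star :: "'a \<Rightarrow> 'a"
  assumes star_star: "star (star r) = r"
    and star_add: "star (r + s) = star r + star s"
    and star_mult: "star (r * s) = star s * star r"

class proper_star_ring = star_ring +
  assumes star_mult_self_eq_0: "star r * r = 0 \<Longrightarrow> r = 0"

definition is_inverse_13 :: "'a::star_ring \<Rightarrow> 'a \<Rightarrow> bool" where
  "is_inverse_13 b z \<longleftrightarrow> b * z * b = b \<and> star (b * z) = b * z"

definition is_drazin_inverse :: "'a::ring_1 \<Rightarrow> 'a \<Rightarrow> bool" where
  "is_drazin_inverse a z \<longleftrightarrow>
     z * a * z = z \<and> a * z = z * a \<and> (\<exists>k>0. z * a ^ (k + 1) = a ^ k)"

definition drazin_invertible :: "'a::ring_1 \<Rightarrow> bool" where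
  "drazin_invertible a \<longleftrightarrow> (\<exists>z. is_drazin_inverse a z)"

text \<open>The Drazin inverse is unique when it exists; \<open>drazin_inverse a\<close> and \<open>drazin_index a\<close>
  are meaningful only for Drazin invertible \<open>a\<close>.  The index is at least 1 by convention, also
  for invertible \<open>a\<close>.\<close>

definition drazin_inverse :: "'a::ring_1 \<Rightarrow> 'a" where
  "drazin_inverse a = (THE z. is_drazin_inverse a z)"

definition drazin_index :: "'a::ring_1 \<Rightarrow> nat" where
  "drazin_index a = (LEAST k. k > 0 \<and> drazin_inverse a * a ^ (k + 1) = a ^ k)"

definition is_weak_core_inverse :: "'a::proper_star_ring \<Rightarrow> 'a \<Rightarrow> bool" where
  "is_weak_core_inverse a y \<longleftrightarrow>
     (\<exists>k>0. y * a ^ (k + 1) = a ^ k \<and> a * y ^ 2 = y \<and> star (a ^ k) * a * y = star (a ^ k))"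

definition weak_core_invertible :: "'a::proper_star_ring \<Rightarrow> bool" where
  "weak_core_invertible a \<longleftrightarrow> (\<exists>y. is_weak_core_inverse a y)"

text \<open>The weak core inverse is likewise unique when it exists.\<close>

definition weak_core_inverse :: "'a::proper_star_ring \<Rightarrow> 'a" where
  "weak_core_inverse a = (THE y. is_weak_core_inverse a y)"

end

theory Submission
  imports Defs
begin

text \<open>
  Write \<open>d\<close> for the Drazin inverse of \<open>a\<close> and put \<open>y = d * a ^ k * z\<close>. Since \<open>d\<close> commutes with
  powers of \<open>a\<close> and \<open>d * a ^ (k + 1) = a ^ k\<close>, the product \<open>a * y\<close> collapses to
  \<open>p = a ^ k * z\<close>, a self-adjoint idempotent with \<open>p * a ^ k = a ^ k\<close>. Hence \<open>a * y\<^sup>2 = p * y = y\<close>,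
  because \<open>y = a ^ k * d * z\<close>; the equation \<open>star (a ^ k) * a * y = star (a ^ k)\<close> is the adjoint of
  \<open>p * a ^ k = a ^ k\<close>; and \<open>y * a ^ (k + 1) = d * p * a ^ (k + 1) = d * a ^ (k + 1) = a ^ k\<close>.

  What remains is that the descriptions used in the definitions determine their objects. Both
  uniqueness proofs rest on one observation: \<open>a * y\<^sup>2 = y\<close> unrolls to \<open>y = a ^ n * y ^ (n + 1)\<close>, so
  \<open>y\<close> is a right multiple of every power of \<open>a\<close>, and an element \<open>x\<close> with \<open>x * a ^ (m + 1) = a ^ m\<close>
  therefore satisfies \<open>x * a * y = y\<close> (lemma \<open>cancel_left_of_power_absorbing\<close>). If \<open>d\<close> and
  \<open>e\<close> are Drazin inverses, this gives \<open>d * a * e = e\<close>, and the mirrored argument, available because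
  both commute with \<open>a\<close>, gives \<open>d * a * e = d\<close>. If \<open>x\<close> and \<open>y\<close> are weak core
  inverses, \<open>a * x - a * y\<close> is a right multiple of \<open>a ^ m\<close> and is annihilated on the left by \<open>star (a ^ m)\<close>, so it vanishes because the involution is proper; then
  \<open>x = y * a * x = y * a * y = y\<close>.

  The exponents witnessing the two candidates may differ, but each equation persists when its
  exponent grows, so their maximum serves both.
\<close>

lemma unroll_right_square:
  fixes a y :: "'a::monoid_mult"
  assumes "a * y ^ 2 = y"
  shows "a ^ n * y ^ (n + 1) = y"
proof (induction n)
  case 0
  show ?case by simp
next
  case (Suc n)
  have "a ^ Suc n * y ^ (Suc n + 1) = a ^ n * (a * y ^ 2 * y ^ n)"
    by (simp only: power_Suc2[of a] add_Suc Suc_eq_plus1[symmetric] power_Suc[of y]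
        power2_eq_square mult.assoc)
  also have "\<dots> = a ^ n * y ^ (n + 1)"
    by (simp add: assms)
  finally show ?case
    using Suc.IH by simp
qed

lemma power_absorbing_mono:
  fixes a y :: "'a::monoid_mult"
  assumes "y * a ^ (k + 1) = a ^ k" and "k \<le> m"
  shows "y * a ^ (m + 1) = a ^ m"
proof -
  have "y * a ^ (m + 1) = y * a ^ (k + 1) * a ^ (m - k)"
    using \<open>k \<le> m\<close> by (simp add: mult.assoc flip: power_add power_Suc)
  also have "\<dots> = a ^ m"
    using assms by (simp flip: power_add)
  finally show ?thesis .
qed

text \<open>
  On right multiples of \<open>a ^ m\<close>, left multiplication by \<open>x * a\<close> is the identity, and \<open>y\<close> is such a
  multiple.
\<close>

lemma cancel_left_of_power_absorbing:
  fixes a x y :: "'a::monoid_mult"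
  assumes "x * a ^ (m + 1) = a ^ m" and "a * y ^ 2 = y"
  shows "x * a * y = y"
proof -
  have "x * a * y = x * a ^ (m + 1) * y ^ (m + 1)"
    using unroll_right_square[OF assms(2), of m] by (simp add: mult.assoc)
  also have "\<dots> = y"
    using assms unroll_right_square by metis
  finally show ?thesis .
qed

text \<open>
  The product \<open>d * a * e\<close> equals both factors: \<open>e\<close> is a right multiple of \<open>a ^ m\<close>, and \<open>d\<close>, by
  commutativity, a left multiple of it.
\<close>

lemma drazin_inverse_unique:
  assumes "is_drazin_inverse a d" and "is_drazin_inverse a e"
  shows "d = e"
proof -
  from assms obtain k l where
    k: "d * a ^ (k + 1) = a ^ k" and l: "e * a ^ (l + 1) = a ^ l"
    and d: "d * a * d = d" "a * d = d * a" and e: "e * a * e = e" "a * e = e * a"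
    unfolding is_drazin_inverse_def by blast
  define m where "m = max k l"
  have dm: "d * a ^ (m + 1) = a ^ m" and em: "e * a ^ (m + 1) = a ^ m"
    using power_absorbing_mono[OF k, of m] power_absorbing_mono[OF l, of m]
    by (simp_all add: m_def)
  have sq_d: "a * d ^ 2 = d" and sq_e: "a * e ^ 2 = e"
    using d e by (simp_all add: power2_eq_square flip: mult.assoc)
  have d_power: "d ^ (m + 1) * a ^ n = a ^ n * d ^ (m + 1)" for n
    using d(2) by (metis power_commuting_commutes)
  have "d = d ^ (m + 1) * a ^ m"
    using unroll_right_square[OF sq_d] d_power by metis
  also have "a ^ m = a ^ (m + 1) * e"
    using em e(2) by (metis power_commuting_commutes)
  also have "d ^ (m + 1) * (a ^ (m + 1) * e) = d ^ (m + 1) * a ^ m * a * e"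
    by (simp add: mult.assoc power_commutes)
  also have "d ^ (m + 1) * a ^ m = d"
    using unroll_right_square[OF sq_d] d_power by metis
  also have "d * a * e = e"
    by (rule cancel_left_of_power_absorbing[OF dm sq_e])
  finally show ?thesis .
qed

lemma drazin_inverse_works:
  assumes "drazin_invertible a"
  shows "is_drazin_inverse a (drazin_inverse a)"
  using assms drazin_inverse_unique unfolding drazin_invertible_def drazin_inverse_def
  by (metis theI)

lemma drazin_index_works:
  assumes "drazin_invertible a"
  shows "drazin_index a > 0 \<and> drazin_inverse a * a ^ (drazin_index a + 1) = a ^ drazin_index a"
proof -
  have "\<exists>k>0. drazin_inverse a * a ^ (k + 1) = a ^ k"
    using drazin_inverse_works[OF assms] unfolding is_drazin_inverse_def by blast
  then show ?thesis
    unfolding drazin_index_def by (rule LeastI_ex)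
qed

lemma star_power_absorbing_mono:
  fixes a y :: "'a::star_ring"
  assumes "star (a ^ k) * a * y = star (a ^ k)" and "k \<le> m"
  shows "star (a ^ m) * a * y = star (a ^ m)"
proof -
  have "star (a ^ m) = star (a ^ (m - k)) * star (a ^ k)"
    using \<open>k \<le> m\<close> by (simp flip: star_mult power_add)
  then show ?thesis
    using assms(1) by (simp add: mult.assoc)
qed

text \<open>
  Properness enters here: a right multiple of \<open>b\<close> that is orthogonal to \<open>b\<close> is orthogonal to
  itself.
\<close>

lemma right_multiple_eq_0_if_orthogonal:
  fixes b w :: "'a::proper_star_ring"
  assumes "star b * (b * w) = 0"
  shows "b * w = 0"
proof (rule star_mult_self_eq_0)
  show "star (b * w) * (b * w) = 0"
    using assms by (simp add: star_mult mult.assoc)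
qed

lemma weak_core_inverse_unique:
  assumes "is_weak_core_inverse a x" and "is_weak_core_inverse a y"
  shows "x = y"
proof -
  from assms obtain k l where
    xk: "x * a ^ (k + 1) = a ^ k" "star (a ^ k) * a * x = star (a ^ k)"
    and yl: "y * a ^ (l + 1) = a ^ l" "star (a ^ l) * a * y = star (a ^ l)"
    and sq_x: "a * x ^ 2 = x" and sq_y: "a * y ^ 2 = y"
    unfolding is_weak_core_inverse_def by blast
  define m where "m = max k l"
  have ym: "y * a ^ (m + 1) = a ^ m"
    using power_absorbing_mono[OF yl(1), of m] by (simp add: m_def)
  have star_eq: "star (a ^ m) * a * x = star (a ^ m) * a * y"
    using star_power_absorbing_mono[OF xk(2), of m] star_power_absorbing_mono[OF yl(2), of m]
    by (simp add: m_def)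
  \<comment> \<open>The unrolled forms of \<open>x\<close> and \<open>y\<close> make \<open>a * x - a * y\<close> a right multiple of \<open>a ^ m\<close>, with
    cofactor \<open>w\<close>.\<close>
  define w where "w = a * x ^ (m + 1) - a * y ^ (m + 1)"
  have factor: "a * u = a ^ m * (a * u ^ (m + 1))" if "a * u ^ 2 = u" for u
  proof -
    have "a * u = a * (a ^ m * u ^ (m + 1))"
      by (simp only: unroll_right_square[OF that])
    then show ?thesis
      by (simp only: power_commutes flip: mult.assoc)
  qed
  have diff: "a * x - a * y = a ^ m * w"
    unfolding w_def right_diff_distrib using factor[OF sq_x] factor[OF sq_y] by simp
  have "star (a ^ m) * (a ^ m * w) = 0"
    using star_eq by (simp add: right_diff_distrib mult.assoc flip: diff)
  then have "a ^ m * w = 0"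
    by (rule right_multiple_eq_0_if_orthogonal)
  then have ax: "a * x = a * y"
    using diff by simp
  have "x = y * a * x"
    by (simp only: cancel_left_of_power_absorbing[OF ym sq_x])
  also have "\<dots> = y * a * y"
    by (simp only: ax mult.assoc)
  also have "\<dots> = y"
    by (rule cancel_left_of_power_absorbing[OF ym sq_y])
  finally show ?thesis .
qed

lemma weak_core_inverse_eqI:
  assumes "is_weak_core_inverse a y"
  shows "weak_core_inverse a = y"
  unfolding weak_core_inverse_def
  using assms weak_core_inverse_unique by (blast intro: the_equality)

text \<open>
  This is the adjoint of \<open>b * z * b = b\<close>, since \<open>b * z\<close> is self-adjoint.
\<close>

lemma inverse_13_star_absorbing:
  assumes "is_inverse_13 b z"
  shows "star b * b * z = star b"
proof -
  have "star b * b * z = star b * star (b * z)"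
    using assms by (simp add: is_inverse_13_def mult.assoc)
  also have "\<dots> = star (b * z * b)"
    by (simp only: star_mult)
  finally show ?thesis
    using assms by (simp add: is_inverse_13_def)
qed

theorem theorem3p12:
  fixes a z :: "'a::proper_star_ring" and k :: nat
  assumes "drazin_invertible a"
    and "drazin_index a = k"
    and "is_inverse_13 (a ^ k) z"
  shows "weak_core_invertible a
    \<and> weak_core_inverse a = drazin_inverse a * a ^ k * z
    \<and> a * weak_core_inverse a = a ^ k * z"
proof -
  define d where "d = drazin_inverse a"
  define y where "y = d * a ^ k * z"
  have k: "k > 0" "d * a ^ (k + 1) = a ^ k"
    using drazin_index_works[OF assms(1)] assms(2) by (auto simp: d_def)
  have comm: "a * d = d * a"
    using drazin_inverse_works[OF assms(1)] by (simp add: is_drazin_inverse_def d_def)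
  have inner: "a ^ k * z * a ^ k = a ^ k"
    using assms(3) by (simp add: is_inverse_13_def)
  have pow_d: "a ^ k * d = d * a ^ k"
    using comm by (rule power_commuting_commutes)
  have ay: "a * y = a ^ k * z"
  proof -
    have "a * y = d * a * a ^ k * z"
      by (simp add: y_def comm flip: mult.assoc)
    also have "\<dots> = d * a ^ (k + 1) * z"
      by (simp add: mult.assoc)
    finally show ?thesis
      by (simp only: k(2))
  qed
  have absorb: "y * a ^ (k + 1) = a ^ k"
  proof -
    have "y * a ^ (k + 1) = d * (a ^ k * z * a ^ k) * a"
      by (simp add: y_def mult.assoc power_commutes)
    also have "\<dots> = d * a ^ (k + 1)"
      by (simp add: inner) (simp add: mult.assoc power_commutes)
    finally show ?thesis
      by (simp only: k(2))
  qed
  have "a * y ^ 2 = a ^ k * z * y"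
    by (simp add: power2_eq_square ay flip: mult.assoc)
  also have "\<dots> = a ^ k * z * (a ^ k * d) * z"
    by (simp only: y_def pow_d mult.assoc)
  also have "\<dots> = a ^ k * z * a ^ k * d * z"
    by (simp only: mult.assoc)
  also have "\<dots> = y"
    by (simp only: inner pow_d y_def)
  finally have square: "a * y ^ 2 = y" .
  have "star (a ^ k) * a * y = star (a ^ k)"
    using inverse_13_star_absorbing[OF assms(3)] by (simp add: mult.assoc ay)
  then have wci: "is_weak_core_inverse a y"
    unfolding is_weak_core_inverse_def using k(1) absorb square by blast
  then have "weak_core_invertible a"
    unfolding weak_core_invertible_def by blast
  moreover have "weak_core_inverse a = y"
    using wci by (rule weak_core_inverse_eqI)
  ultimately show ?thesis
    using ay by (simp add: y_def d_def)
qed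

end
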